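(* Let $T\in\mathcal F$ be a trigraph with no balanced skew-partition and let $X$ be a fragment of $T$. Then the block of decomposition $T_X$ belongs to $\mathcal F$.
   Context: Trigraphs: a finite vertex set $V(T)$ with $\theta:\binom{V(T)}{2}\to\{-1,0,1\}$; $u,v$ strongly adjacent if $\theta(uv)=1$, strongly antiadjacent if $-1$, a switchable pair if $0$; adjacent if $\theta\in\{0,1\}$, antiadjacent if $\theta\in\{-1,0\}$. Complement $\overline T$: adjacency $-\theta$; $T|X$: induced trigraph. Strongly complete/anticomplete: strongly adjacent/antiadjacent to all vertices of a set. Full realization: graph on $V(T)$ of adjacent pairs. $X$ connected: full realization of $T|X$ connected; anticonnected: complement of the graph on $X$ of strongly adjacent pairs connected; components = maximal connected subsets. Path: distinct $p_1,\dots,p_k$, consecutive adjacent, non-consecutive antiadjacent (length $k-1$, interior = inner vertices). Hole: distinct $h_1,\dots,h_k$, $k\ge4$, $h_i,h_j$ adjacent iff $|i-j|\in\{1,k-1\}$, otherwise antiadjacent (length $k$). Antipath/antihole: induced subtrigraph whose complement is a path/hole in $\overline T$. Berge: no odd hole and no odd antihole. Skew-partition: partition $(A,B)$ of $V(T)$, $A$ not connected, $B$ not anticonnected; balanced if no path of odd length $>1$ has ends in $B$ and interior in $A$, and no antipath of odd length $>1$ has ends in $A$ and interior in $B$. $\mathcal F$: with $\Sigma(T)$ the graph of switchable pairs, $T\in\mathcal F$ iff $T$ is Berge, each component of $\Sigma(T)$ has at most two edges, and each vertex $v$ of degree two in $\Sigma(T)$ with $\Sigma(T)$-neighbours $x,y$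 is either strongly complete to $V(T)\setminus\{v,x,y\}$ with $x,y$ strongly adjacent, or strongly anticomplete to $V(T)\setminus\{v,x,y\}$ with $x,y$ strongly antiadjacent. $2$-join: a partition $(X_1,X_2)$ of $V(T)$ with disjoint sets $A_1,B_1,C_1,A_2,B_2,C_2$ (a split), $X_i=A_i\cup B_i\cup C_i$, $A_1,A_2,B_1,B_2\neq\emptyset$, no switchable pair meeting both $X_1,X_2$, $A_1$ strongly complete to $A_2$, $B_1$ strongly complete to $B_2$, all other pairs between $X_1$ and $X_2$ strongly antiadjacent, $|X_i|\ge3$, and if $|A_i|=|B_i|=1$ the full realization of $T|X_i$ is not a path of length two between the vertices of $A_i$ and $B_i$. Proper: for $i=1,2$ each component of $T|X_i$ meets $A_i$ and $B_i$. A (proper) complement $2$-join of $T$ is a (proper) $2$-join of $\overline T$, with the same split. For a Berge trigraph and a proper $2$-join, all paths with one end in $A_i$, the other in $B_i$ and interior in $C_i$ ($i=1,2$) have lengths of the same parity; the $2$-join is odd or even accordingly; a complement $2$-join is odd/even if it is so as a $2$-join of $\overline T$. Fragment: $X\subseteq V(T)$ such that $(X,V(T)\setminus X)$ is a proper $2$-join or a proper complement $2$-join of $T$. Block $T_X$ (with $X=X_1$ and a split $(A_1,B_1,C_1,A_2,B_2,C_2)$ of $(X_1,X_2)$), starting from $T|X_1$ and adding new marker vertices, with all pairs not specified strongly antiadjacent: odd $2$-join: add $a,b$ with $a$ strongly complete to $A_1$, $b$ strongly complete to $B_1$, $ab$ switchable. Even $2$-join: add $a,b,c$ with $a$ strongly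 complete to $A_1$, $b$ strongly complete to $B_1$, $ac$ and $cb$ switchable pairs. Odd complement $2$-join: add $a,b$ with $a$ strongly complete to $B_1\cup C_1$, $b$ strongly complete to $A_1\cup C_1$, $ab$ switchable. Even complement $2$-join: add $a,b,c$ with $a$ strongly complete to $B_1\cup C_1$, $b$ strongly complete to $A_1\cup C_1$, $c$ strongly complete to $X_1$, $ac,cb$ switchable pairs, $ab$ strongly adjacent. *)

theory Defs
  imports Main
begin

section \<open>Trigraphs\<close>

text \<open>The adjacency function is applied to unordered pairs, i.e. two-element sets of vertices; its
  values on all other sets are irrelevant.\<close>

datatype 'a trigraph = Trigraph (verts: "'a set") (theta: "'a set \<Rightarrow> int")

definition trigraph :: "'a trigraph \<Rightarrow> bool" where
  "trigraph T \<longleftrightarrow> finite (verts T) \<and>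
     (\<forall>e. e \<subseteq> verts T \<and> card e = 2 \<longrightarrow> theta T e \<in> {-1, 0, 1})"

definition vertex_pair :: "'a trigraph \<Rightarrow> 'a \<Rightarrow> 'a \<Rightarrow> bool" where
  "vertex_pair T u v \<longleftrightarrow> u \<in> verts T \<and> v \<in> verts T \<and> u \<noteq> v"

definition strongly_adjacent :: "'a trigraph \<Rightarrow> 'a \<Rightarrow> 'a \<Rightarrow> bool" where
  "strongly_adjacent T u v \<longleftrightarrow> vertex_pair T u v \<and> theta T {u, v} = 1"

definition strongly_antiadjacent :: "'a trigraph \<Rightarrow> 'a \<Rightarrow> 'a \<Rightarrow> bool" where
  "strongly_antiadjacent T u v \<longleftrightarrow> vertex_pair T u v \<and> theta T {u, v} = -1"

definition switchable :: "'a trigraph \<Rightarrow> 'a \<Rightarrow> 'a \<Rightarrow> bool" where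
  "switchable T u v \<longleftrightarrow> vertex_pair T u v \<and> theta T {u, v} = 0"

definition adjacent :: "'a trigraph \<Rightarrow> 'a \<Rightarrow> 'a \<Rightarrow> bool" where
  "adjacent T u v \<longleftrightarrow> vertex_pair T u v \<and> theta T {u, v} \<in> {0, 1}"

definition antiadjacent :: "'a trigraph \<Rightarrow> 'a \<Rightarrow> 'a \<Rightarrow> bool" where
  "antiadjacent T u v \<longleftrightarrow> vertex_pair T u v \<and> theta T {u, v} \<in> {-1, 0}"

definition complement :: "'a trigraph \<Rightarrow> 'a trigraph" where
  "complement T = Trigraph (verts T) (\<lambda>e. - theta T e)"

definition induced :: "'a trigraph \<Rightarrow> 'a set \<Rightarrow> 'a trigraph" where
  "induced T X = Trigraph X (theta T)"

definition strongly_complete :: "'a trigraph \<Rightarrow> 'a set \<Rightarrow> 'a set \<Rightarrow> bool" where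
  "strongly_complete T X Y \<longleftrightarrow> (\<forall>u\<in>X. \<forall>v\<in>Y. strongly_adjacent T u v)"

definition strongly_anticomplete :: "'a trigraph \<Rightarrow> 'a set \<Rightarrow> 'a set \<Rightarrow> bool" where
  "strongly_anticomplete T X Y \<longleftrightarrow> (\<forall>u\<in>X. \<forall>v\<in>Y. strongly_antiadjacent T u v)"


section \<open>Connectivity\<close>

text \<open>A graph is given by its vertex set and its edge relation, which is taken to be restricted to
  the vertex set. The graph without vertices is connected, so both sides of a
  skew-partition are nonempty.\<close>

definition graph_connected :: "'a set \<Rightarrow> ('a \<Rightarrow> 'a \<Rightarrow> bool) \<Rightarrow> bool" where
  "graph_connected V E \<longleftrightarrow>
     (\<forall>u\<in>V. \<forall>v\<in>V. (\<lambda>x y. x \<in> V \<and> y \<in> V \<and> E x y)\<^sup>*\<^sup>* u v)"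

definition graph_component :: "'a set \<Rightarrow> ('a \<Rightarrow> 'a \<Rightarrow> bool) \<Rightarrow> 'a set \<Rightarrow> bool" where
  "graph_component V E Y \<longleftrightarrow> Y \<subseteq> V \<and> graph_connected Y E \<and>
     (\<forall>Z. Y \<subseteq> Z \<and> Z \<subseteq> V \<and> graph_connected Z E \<longrightarrow> Z = Y)"

definition connected :: "'a trigraph \<Rightarrow> 'a set \<Rightarrow> bool" where
  "connected T X \<longleftrightarrow> graph_connected X (adjacent (induced T X))"

definition anticonnected :: "'a trigraph \<Rightarrow> 'a set \<Rightarrow> bool" where
  "anticonnected T X \<longleftrightarrow>
     graph_connected X (\<lambda>u v. u \<noteq> v \<and> \<not> strongly_adjacent (induced T X) u v)"

definition component :: "'a trigraph \<Rightarrow> 'a set \<Rightarrow> bool" where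
  "component T Y \<longleftrightarrow> Y \<subseteq> verts T \<and> connected T Y \<and>
     (\<forall>Z. Y \<subseteq> Z \<and> Z \<subseteq> verts T \<and> connected T Z \<longrightarrow> Z = Y)"


section \<open>Paths, holes and Berge trigraphs\<close>

definition path :: "'a trigraph \<Rightarrow> 'a list \<Rightarrow> bool" where
  "path T p \<longleftrightarrow> p \<noteq> [] \<and> distinct p \<and> set p \<subseteq> verts T \<and>
     (\<forall>i j. i < j \<and> j < length p \<longrightarrow>
        (if j - i = 1 then adjacent T (p ! i) (p ! j) else antiadjacent T (p ! i) (p ! j)))"

definition path_length :: "'a list \<Rightarrow> nat" where
  "path_length p = length p - 1"

definition interior :: "'a list \<Rightarrow> 'a set" where
  "interior p = set (butlast (tl p))"

text \<open>The conditions on a hole are not exclusive: a switchable pair may occur as a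
  consecutive or as a non-consecutive pair, exactly as for paths.\<close>

definition hole :: "'a trigraph \<Rightarrow> 'a list \<Rightarrow> bool" where
  "hole T h \<longleftrightarrow> 4 \<le> length h \<and> distinct h \<and> set h \<subseteq> verts T \<and>
     (\<forall>i j. i < j \<and> j < length h \<longrightarrow>
        (if j - i \<in> {1, length h - 1} then adjacent T (h ! i) (h ! j)
         else antiadjacent T (h ! i) (h ! j)))"

definition antipath :: "'a trigraph \<Rightarrow> 'a list \<Rightarrow> bool" where
  "antipath T p \<longleftrightarrow> path (complement T) p"

definition antihole :: "'a trigraph \<Rightarrow> 'a list \<Rightarrow> bool" where
  "antihole T h \<longleftrightarrow> hole (complement T) h"

definition Berge :: "'a trigraph \<Rightarrow> bool" where
  "Berge T \<longleftrightarrow> (\<nexists>h. hole T h \<and> odd (length h)) \<and> (\<nexists>h. antihole T h \<and> odd (length h))"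


section \<open>Balanced skew-partitions\<close>

definition skew_partition :: "'a trigraph \<Rightarrow> 'a set \<Rightarrow> 'a set \<Rightarrow> bool" where
  "skew_partition T A B \<longleftrightarrow> A \<union> B = verts T \<and> A \<inter> B = {} \<and>
     \<not> connected T A \<and> \<not> anticonnected T B"

definition balanced_skew_partition :: "'a trigraph \<Rightarrow> 'a set \<Rightarrow> 'a set \<Rightarrow> bool" where
  "balanced_skew_partition T A B \<longleftrightarrow> skew_partition T A B \<and>
     (\<nexists>p. path T p \<and> odd (path_length p) \<and> 1 < path_length p \<and>
          hd p \<in> B \<and> last p \<in> B \<and> interior p \<subseteq> A) \<and>
     (\<nexists>p. antipath T p \<and> odd (path_length p) \<and> 1 < path_length p \<and>
          hd p \<in> A \<and> last p \<in> A \<and> interior p \<subseteq> B)"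


section \<open>The class F\<close>

definition class_F :: "'a trigraph set" where
  "class_F = {T. trigraph T \<and> Berge T \<and>
     (\<forall>Y. graph_component (verts T) (switchable T) Y \<longrightarrow>
        card {{u, v} | u v. u \<in> Y \<and> v \<in> Y \<and> switchable T u v} \<le> 2) \<and>
     (\<forall>v x y. v \<in> verts T \<and> x \<noteq> y \<and> {w. switchable T v w} = {x, y} \<longrightarrow>
        (strongly_complete T {v} (verts T - {v, x, y}) \<and> strongly_adjacent T x y) \<or>
        (strongly_anticomplete T {v} (verts T - {v, x, y}) \<and> strongly_antiadjacent T x y))}"


section \<open>2-joins\<close>

definition two_join_side :: "'a trigraph \<Rightarrow> 'a set \<Rightarrow> 'a set \<Rightarrow> 'a set \<Rightarrow> bool" where
  "two_join_side T A B C \<longleftrightarrow>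
     A \<inter> B = {} \<and> A \<inter> C = {} \<and> B \<inter> C = {} \<and> A \<noteq> {} \<and> B \<noteq> {} \<and>
     3 \<le> card (A \<union> B \<union> C) \<and>
     (\<forall>a b. A = {a} \<and> B = {b} \<longrightarrow>
        \<not> (\<exists>c. C = {c} \<and> adjacent T a c \<and> adjacent T c b \<and> \<not> adjacent T a b))"

definition two_join ::
  "'a trigraph \<Rightarrow> 'a set \<Rightarrow> 'a set \<Rightarrow> 'a set \<Rightarrow> 'a set \<Rightarrow> 'a set \<Rightarrow> 'a set \<Rightarrow> bool" where
  "two_join T A1 B1 C1 A2 B2 C2 \<longleftrightarrow>
     (let X1 = A1 \<union> B1 \<union> C1; X2 = A2 \<union> B2 \<union> C2 in
        X1 \<union> X2 = verts T \<and> X1 \<inter> X2 = {} \<and>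
        two_join_side T A1 B1 C1 \<and> two_join_side T A2 B2 C2 \<and>
        (\<forall>u\<in>X1. \<forall>v\<in>X2. \<not> switchable T u v) \<and>
        strongly_complete T A1 A2 \<and> strongly_complete T B1 B2 \<and>
        (\<forall>u\<in>X1. \<forall>v\<in>X2. \<not> (u \<in> A1 \<and> v \<in> A2) \<and> \<not> (u \<in> B1 \<and> v \<in> B2)
           \<longrightarrow> strongly_antiadjacent T u v))"

definition proper_side :: "'a trigraph \<Rightarrow> 'a set \<Rightarrow> 'a set \<Rightarrow> 'a set \<Rightarrow> bool" where
  "proper_side T A B C \<longleftrightarrow>
     (\<forall>Y. component (induced T (A \<union> B \<union> C)) Y \<longrightarrow> Y \<inter> A \<noteq> {} \<and> Y \<inter> B \<noteq> {})"

definition proper_two_join ::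
  "'a trigraph \<Rightarrow> 'a set \<Rightarrow> 'a set \<Rightarrow> 'a set \<Rightarrow> 'a set \<Rightarrow> 'a set \<Rightarrow> 'a set \<Rightarrow> bool" where
  "proper_two_join T A1 B1 C1 A2 B2 C2 \<longleftrightarrow> two_join T A1 B1 C1 A2 B2 C2 \<and>
     proper_side T A1 B1 C1 \<and> proper_side T A2 B2 C2"

definition proper_complement_two_join ::
  "'a trigraph \<Rightarrow> 'a set \<Rightarrow> 'a set \<Rightarrow> 'a set \<Rightarrow> 'a set \<Rightarrow> 'a set \<Rightarrow> 'a set \<Rightarrow> bool" where
  "proper_complement_two_join T = proper_two_join (complement T)"

definition fragment :: "'a trigraph \<Rightarrow> 'a set \<Rightarrow> bool" where
  "fragment T X \<longleftrightarrow> (\<exists>A1 B1 C1 A2 B2 C2.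
     X = A1 \<union> B1 \<union> C1 \<and> verts T - X = A2 \<union> B2 \<union> C2 \<and>
     (proper_two_join T A1 B1 C1 A2 B2 C2 \<or> proper_complement_two_join T A1 B1 C1 A2 B2 C2))"

definition side_path :: "'a trigraph \<Rightarrow> 'a set \<Rightarrow> 'a set \<Rightarrow> 'a set \<Rightarrow> 'a list \<Rightarrow> bool" where
  "side_path T A B C p \<longleftrightarrow> path T p \<and> hd p \<in> A \<and> last p \<in> B \<and> interior p \<subseteq> C"

text \<open>For a proper 2-join of a Berge trigraph, side paths exist on both sides and their lengths
  all have the same parity, so such a 2-join is even iff it is not odd.\<close>

definition odd_two_join ::
  "'a trigraph \<Rightarrow> 'a set \<Rightarrow> 'a set \<Rightarrow> 'a set \<Rightarrow> 'a set \<Rightarrow> 'a set \<Rightarrow> 'a set \<Rightarrow> bool" where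
  "odd_two_join T A1 B1 C1 A2 B2 C2 \<longleftrightarrow>
     (\<forall>p. side_path T A1 B1 C1 p \<or> side_path T A2 B2 C2 p \<longrightarrow> odd (path_length p))"


section \<open>Blocks of decomposition\<close>

datatype 'a block_vertex = Orig 'a | Mark_a | Mark_b | Mark_c

definition star :: "'a block_vertex \<Rightarrow> 'a set \<Rightarrow> 'a block_vertex set set" where
  "star m S = {{m, Orig u} | u. u \<in> S}"

text \<open>The trigraph obtained from the one induced on \<open>X\<close> by adding the marker vertices \<open>M\<close>, where
  \<open>S\<close> are the new strongly adjacent pairs and \<open>W\<close> the new switchable pairs; all other new pairs
  are strongly antiadjacent.\<close>

definition add_markers ::
  "'a trigraph \<Rightarrow> 'a set \<Rightarrow> 'a block_vertex set \<Rightarrow> 'a block_vertex set set \<Rightarrow>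
   'a block_vertex set set \<Rightarrow> 'a block_vertex trigraph" where
  "add_markers T X M S W = Trigraph (Orig ` X \<union> M)
     (\<lambda>e. if e \<subseteq> Orig ` X then theta T (Orig -` e)
          else if e \<in> S then 1 else if e \<in> W then 0 else -1)"

definition odd_block :: "'a trigraph \<Rightarrow> 'a set \<Rightarrow> 'a set \<Rightarrow> 'a set \<Rightarrow> 'a block_vertex trigraph" where
  "odd_block T A1 B1 C1 = add_markers T (A1 \<union> B1 \<union> C1) {Mark_a, Mark_b}
     (star Mark_a A1 \<union> star Mark_b B1)
     {{Mark_a, Mark_b}}"

definition even_block :: "'a trigraph \<Rightarrow> 'a set \<Rightarrow> 'a set \<Rightarrow> 'a set \<Rightarrow> 'a block_vertex trigraph" where
  "even_block T A1 B1 C1 = add_markers T (A1 \<union> B1 \<union> C1) {Mark_a, Mark_b, Mark_c}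
     (star Mark_a A1 \<union> star Mark_b B1)
     {{Mark_a, Mark_c}, {Mark_c, Mark_b}}"

definition odd_complement_block ::
  "'a trigraph \<Rightarrow> 'a set \<Rightarrow> 'a set \<Rightarrow> 'a set \<Rightarrow> 'a block_vertex trigraph" where
  "odd_complement_block T A1 B1 C1 = add_markers T (A1 \<union> B1 \<union> C1) {Mark_a, Mark_b}
     (star Mark_a (B1 \<union> C1) \<union> star Mark_b (A1 \<union> C1))
     {{Mark_a, Mark_b}}"

definition even_complement_block ::
  "'a trigraph \<Rightarrow> 'a set \<Rightarrow> 'a set \<Rightarrow> 'a set \<Rightarrow> 'a block_vertex trigraph" where
  "even_complement_block T A1 B1 C1 = add_markers T (A1 \<union> B1 \<union> C1) {Mark_a, Mark_b, Mark_c}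
     (star Mark_a (B1 \<union> C1) \<union> star Mark_b (A1 \<union> C1) \<union> star Mark_c (A1 \<union> B1 \<union> C1)
        \<union> {{Mark_a, Mark_b}})
     {{Mark_a, Mark_c}, {Mark_c, Mark_b}}"

text \<open>The block depends on the split and on whether a 2-join or a complement 2-join is used, hence
  it is a relation between \<open>X\<close> and the resulting trigraph.\<close>

definition block_of_decomposition :: "'a trigraph \<Rightarrow> 'a set \<Rightarrow> 'a block_vertex trigraph \<Rightarrow> bool" where
  "block_of_decomposition T X TX \<longleftrightarrow> (\<exists>A1 B1 C1 A2 B2 C2.
     X = A1 \<union> B1 \<union> C1 \<and> verts T - X = A2 \<union> B2 \<union> C2 \<and>
     (proper_two_join T A1 B1 C1 A2 B2 C2 \<and>
        TX = (if odd_two_join T A1 B1 C1 A2 B2 C2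
              then odd_block T A1 B1 C1 else even_block T A1 B1 C1) \<or>
      proper_complement_two_join T A1 B1 C1 A2 B2 C2 \<and>
        TX = (if odd_two_join (complement T) A1 B1 C1 A2 B2 C2
              then odd_complement_block T A1 B1 C1 else even_complement_block T A1 B1 C1)))"

end

theory Submission
  imports Defs
begin

text \<open>Complementing \<open>T\<close> exchanges 2-joins with complement 2-joins and the corresponding blocks, so
  only blocks of 2-joins matter.

  A hole or antihole of a block that avoids \<open>c\<close> and one of \<open>a\<close> and \<open>b\<close> becomes one of \<open>T\<close> when
  the other marker is replaced by a vertex of \<open>A\<^sub>2\<close> or \<open>B\<^sub>2\<close>. A hole through \<open>c\<close> contains \<open>a\<close> and
  \<open>b\<close>, and a hole through \<open>a\<close> and \<open>b\<close> is cut by them into two segments. A segment is empty,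
  consists of \<open>c\<close>, or is a path from \<open>A\<^sub>1\<close> to \<open>B\<^sub>1\<close> with interior in \<open>C\<^sub>1\<close>. Joining such a path
  with one on the other side gives a hole of \<open>T\<close>, so its length has the parity of the 2-join. In
  all three cases the number of vertices of the segment is even iff the 2-join is odd, hence the
  hole is even. An antihole of length 5 is a hole. In an antihole of length \<open>n \<ge> 7\<close> every vertex
  has at least \<open>n - 3\<close> neighbours, so \<open>c\<close>, which has only two, is not in it, and neither are both
  \<open>a\<close> and \<open>b\<close>, which have no common neighbour but \<open>c\<close>.

  A vertex of \<open>X\<^sub>1\<close> is not complete to \<open>X\<^sub>2\<close>, so if it has degree two in the graph of switchable
  pairs, it is strongly anticomplete to the rest, which puts it in \<open>C\<^sub>1\<close>, away from the markers.\<close>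


section \<open>Adjacency and complements\<close>

lemma vertex_pair_sym: "vertex_pair T u v \<longleftrightarrow> vertex_pair T v u"
  by (auto simp: vertex_pair_def)

lemma adjacent_sym: "adjacent T u v \<longleftrightarrow> adjacent T v u"
  by (simp add: adjacent_def vertex_pair_sym[of T u] insert_commute)

lemma antiadjacent_sym: "antiadjacent T u v \<longleftrightarrow> antiadjacent T v u"
  by (simp add: antiadjacent_def vertex_pair_sym[of T u] insert_commute)

lemma switchable_sym: "switchable T u v \<longleftrightarrow> switchable T v u"
  by (simp add: switchable_def vertex_pair_sym[of T u] insert_commute)

lemma strongly_antiadjacent_sym: "strongly_antiadjacent T u v \<longleftrightarrow> strongly_antiadjacent T v u"
  by (simp add: strongly_antiadjacent_def vertex_pair_sym[of T u] insert_commute)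

lemma adjacent_imp_vertex_pair: "adjacent T u v \<Longrightarrow> vertex_pair T u v"
  by (simp add: adjacent_def)

lemma trigraph_iff_pairs:
  "trigraph T \<longleftrightarrow>
     finite (verts T) \<and> (\<forall>u v. vertex_pair T u v \<longrightarrow> theta T {u, v} \<in> {-1, 0, 1})"
proof -
  have "e \<subseteq> verts T \<and> card e = 2 \<longleftrightarrow> (\<exists>u v. e = {u, v} \<and> vertex_pair T u v)" for e
    by (auto simp: vertex_pair_def card_2_iff)
  then show ?thesis unfolding trigraph_def by metis
qed

lemma adjacent_or_antiadjacent:
  "trigraph T \<Longrightarrow> vertex_pair T u v \<Longrightarrow> adjacent T u v \<or> antiadjacent T u v"
  by (auto simp: trigraph_iff_pairs adjacent_def antiadjacent_def)

lemma verts_complement [simp]: "verts (complement T) = verts T"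
  by (simp add: complement_def)

lemma theta_complement [simp]: "theta (complement T) e = - theta T e"
  by (simp add: complement_def)

lemma complement_complement [simp]: "complement (complement T) = T"
  by (cases T) (simp add: complement_def)

lemma trigraph_complement [simp]: "trigraph (complement T) \<longleftrightarrow> trigraph T"
proof -
  have "- x \<in> {-1, 0, 1} \<longleftrightarrow> x \<in> {-1, 0, 1}" for x :: int by auto
  then show ?thesis by (simp only: trigraph_def verts_complement theta_complement)
qed

lemma vertex_pair_complement [simp]: "vertex_pair (complement T) = vertex_pair T"
  by (simp add: fun_eq_iff vertex_pair_def)

lemma adjacent_complement [simp]: "adjacent (complement T) = antiadjacent T"
  by (auto simp: fun_eq_iff adjacent_def antiadjacent_def)

lemma antiadjacent_complement [simp]: "antiadjacent (complement T) = adjacent T"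
  by (auto simp: fun_eq_iff adjacent_def antiadjacent_def)

lemma switchable_complement [simp]: "switchable (complement T) = switchable T"
  by (simp add: fun_eq_iff switchable_def)

lemma strongly_adjacent_complement [simp]:
  "strongly_adjacent (complement T) = strongly_antiadjacent T"
  by (auto simp: fun_eq_iff strongly_adjacent_def strongly_antiadjacent_def)

lemma strongly_antiadjacent_complement [simp]:
  "strongly_antiadjacent (complement T) = strongly_adjacent T"
  by (auto simp: fun_eq_iff strongly_adjacent_def strongly_antiadjacent_def)

lemma Berge_complement [simp]: "Berge (complement T) \<longleftrightarrow> Berge T"
  by (auto simp: Berge_def antihole_def)


section \<open>Paths and holes\<close>

lemma all_less_Suc_pairs:
  "(\<forall>i j. i < j \<and> j < Suc n \<longrightarrow> P i j) \<longleftrightarrow>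
     (\<forall>j<n. P 0 (Suc j)) \<and> (\<forall>i j. i < j \<and> j < n \<longrightarrow> P (Suc i) (Suc j))" (is "?L \<longleftrightarrow> ?R")
proof
  assume R: ?R
  show ?L
  proof (intro allI impI)
    fix i j assume "i < j \<and> j < Suc n"
    then show "P i j" using R by (cases i; cases j) auto
  qed
qed auto

lemma path_Nil [simp]: "\<not> path T []"
  by (simp add: path_def)

lemma path_single [simp]: "path T [x] \<longleftrightarrow> x \<in> verts T"
  by (auto simp: path_def)

lemma path_Cons [simp]:
  "path T (x # y # p) \<longleftrightarrow>
     adjacent T x y \<and> (\<forall>z\<in>set p. antiadjacent T x z) \<and> path T (y # p)"
proof -
  have "x \<in> verts T \<and> x \<notin> set (y # p)" if "adjacent T x y" "\<forall>z\<in>set p. antiadjacent T x z"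
    using that by (auto simp: adjacent_def antiadjacent_def vertex_pair_def)
  moreover have "path T (x # y # p) \<longleftrightarrow> x \<in> verts T \<and> x \<notin> set (y # p) \<and> adjacent T x y \<and>
      (\<forall>k<length p. antiadjacent T x (p ! k)) \<and> path T (y # p)"
    unfolding path_def list.size add_Suc_right add_0_right all_less_Suc_pairs[where n = "Suc _"]
    by (auto simp: All_less_Suc2)
  ultimately show ?thesis unfolding all_set_conv_all_nth by blast
qed

lemma path_append:
  assumes "xs \<noteq> []" "ys \<noteq> []"
  shows "path T (xs @ ys) \<longleftrightarrow> path T xs \<and> path T ys \<and> adjacent T (last xs) (hd ys) \<and>
    (\<forall>x\<in>set (butlast xs). \<forall>y\<in>set ys. antiadjacent T x y) \<and>
    (\<forall>y\<in>set (tl ys). antiadjacent T (last xs) y)"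
  using assms(1)
proof (induction xs rule: list_nonempty_induct)
  case (single x)
  then show ?case using assms(2)
    by (cases ys) (auto simp: adjacent_def vertex_pair_def)
next
  case (cons x xs)
  then obtain y zs where "xs = y # zs" by (cases xs) auto
  then show ?case using cons by auto
qed

lemma path_appendD:
  assumes "path T (xs @ ys)"
  shows "xs \<noteq> [] \<Longrightarrow> path T xs" "ys \<noteq> [] \<Longrightarrow> path T ys"
  using assms path_append[of xs ys T] by (cases "xs = []"; cases "ys = []"; simp)+

lemma path_rev: "path T p \<Longrightarrow> path T (rev p)"
proof (induction p rule: induct_list012)
  case (3 x y p)
  then have "path T (rev (y # p))" "path T [x]" "\<forall>z\<in>set (rev p). antiadjacent T z x"
    by (auto simp: antiadjacent_sym adjacent_def vertex_pair_def)
  then show ?case using 3 path_append[of "rev (y # p)" "[x]" T]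
    by (simp add: adjacent_sym)
qed auto

lemma interior_Cons_snoc [simp]: "interior (x # p @ [y]) = set p"
  by (simp add: interior_def)

lemma interior_map: "interior (map f p) = f ` interior p"
  by (simp add: interior_def map_tl[symmetric] map_butlast[symmetric] del: map_tl)

lemma interior_rev [simp]: "interior (rev p) = interior p"
  by (metis butlast_rev butlast_tl interior_def rev_rev_ident set_rev)

lemma interior_subset:
  "interior p \<subseteq> set p" "interior p \<subseteq> set (tl p)" "interior p \<subseteq> set (butlast p)"
  by (cases p; auto simp: interior_def dest: in_set_butlastD)+

lemma distinct_card_interior: "distinct p \<Longrightarrow> card (interior p) = length p - 2"
  by (simp add: interior_def distinct_card distinct_butlast distinct_tl)

lemma list_ends:
  assumes "2 \<le> length p"
  obtains x m y where "p = x # m @ [y]"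
proof -
  obtain x q where "p = x # q" "q \<noteq> []" using assms by (cases p) (auto simp: Suc_le_eq)
  then show thesis using that[of x "butlast q" "last q"] by simp
qed

lemma hole_Cons_nth:
  "hole T (v # p) \<longleftrightarrow> 3 \<le> length p \<and> path T p \<and> v \<in> verts T \<and> v \<notin> set p \<and>
     (\<forall>k<length p. if k = 0 \<or> k = length p - 1 then adjacent T v (p ! k)
        else antiadjacent T v (p ! k))"
proof -
  define pair where "pair i j \<longleftrightarrow>
    (if j - i \<in> {1, length p} then adjacent T ((v # p) ! i) ((v # p) ! j)
     else antiadjacent T ((v # p) ! i) ((v # p) ! j))" for i j
  have length_eq: "4 \<le> length (v # p) \<longleftrightarrow> 3 \<le> length p" by auto
  have "hole T (v # p) \<longleftrightarrow> 3 \<le> length p \<and> distinct (v # p) \<and> set (v # p) \<subseteq> verts T \<and>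
      (\<forall>i j. i < j \<and> j < Suc (length p) \<longrightarrow> pair i j)"
    unfolding hole_def pair_def length_eq unfolding length_Cons diff_Suc_1 by (rule refl)
  moreover have "pair 0 (Suc k) \<longleftrightarrow> (if k = 0 \<or> k = length p - 1 then adjacent T v (p ! k)
      else antiadjacent T v (p ! k))" if "k < length p" for k
  proof -
    have "Suc k - 0 \<in> {1, length p} \<longleftrightarrow> k = 0 \<or> k = length p - 1" using that by auto
    then show ?thesis unfolding pair_def by (simp only: nth_Cons_0 nth_Cons_Suc)
  qed
  moreover have "pair (Suc i) (Suc j) \<longleftrightarrow>
      (if j - i = 1 then adjacent T (p ! i) (p ! j) else antiadjacent T (p ! i) (p ! j))"
    if "i < j" "j < length p" for i j
  proof -
    have "Suc j - Suc i \<in> {1, length p} \<longleftrightarrow> j - i = 1" using that by auto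
    then show ?thesis unfolding pair_def by (simp only: nth_Cons_Suc)
  qed
  ultimately show ?thesis unfolding all_less_Suc_pairs[of _ pair] path_def by auto
qed

lemma hole_Cons_ends:
  "hole T (v # x # m @ [y]) \<longleftrightarrow> m \<noteq> [] \<and> path T (x # m @ [y]) \<and>
     adjacent T v x \<and> adjacent T v y \<and> (\<forall>z\<in>set m. antiadjacent T v z)"
proof -
  let ?p = "x # m @ [y]"
  have "(\<forall>k<length ?p. if k = 0 \<or> k = length ?p - 1 then adjacent T v (?p ! k)
        else antiadjacent T v (?p ! k)) \<longleftrightarrow>
      adjacent T v x \<and> adjacent T v y \<and> (\<forall>z\<in>set m. antiadjacent T v z)"
    unfolding length_Cons All_less_Suc2 unfolding length_append_singleton All_less_Suc
    by (auto simp: nth_append all_set_conv_all_nth)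
  moreover have "v \<in> verts T \<and> v \<notin> set ?p"
    if "adjacent T v x" "adjacent T v y" "\<forall>z\<in>set m. antiadjacent T v z"
    using that by (auto simp: adjacent_def antiadjacent_def vertex_pair_def)
  ultimately show ?thesis unfolding hole_Cons_nth by (auto simp: Suc_le_eq numeral_3_eq_3)
qed

lemma hole_Cons:
  "hole T (v # p) \<longleftrightarrow> 3 \<le> length p \<and> path T p \<and> adjacent T v (hd p) \<and> adjacent T v (last p) \<and>
     (\<forall>z\<in>interior p. antiadjacent T v z)"
proof (cases "2 \<le> length p")
  case True
  then obtain x m y where "p = x # m @ [y]" by (rule list_ends)
  then show ?thesis by (auto simp: hole_Cons_ends Suc_le_eq numeral_3_eq_3)
qed (simp add: hole_def)

lemma hole_length: "hole T h \<Longrightarrow> 4 \<le> length h"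
  by (simp add: hole_def)

lemma hole_distinct: "hole T h \<Longrightarrow> distinct h"
  by (simp add: hole_def)

lemma hole_verts: "hole T h \<Longrightarrow> set h \<subseteq> verts T"
  by (simp add: hole_def)

lemma hole_rev_tl: "hole T (v # p) \<Longrightarrow> hole T (v # rev p)"
  by (auto simp: hole_Cons path_rev hd_rev last_rev)

lemma hole_rotate1:
  assumes "hole T h"
  shows "hole T (rotate1 h)"
proof -
  obtain v p where h: "h = v # p" using assms by (cases h) (auto simp: hole_def)
  then have "2 \<le> length p" using hole_length[OF assms] by simp
  then obtain x m y where p: "p = x # m @ [y]" by (rule list_ends)
  have v_path: "m \<noteq> []" "path T (x # m @ [y])" "adjacent T v x" "adjacent T v y"
    "\<forall>z\<in>set m. antiadjacent T v z"
    using assms unfolding h p hole_Cons_ends by blast+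
  then obtain a n where m: "m = a # n" by (cases m) auto
  have "path T ((m @ [y]) @ [v])"
    using v_path by (subst path_append)
      (auto simp: m adjacent_sym antiadjacent_sym adjacent_def[of T v] vertex_pair_def)
  then have "hole T (x # a # (n @ [y]) @ [v])"
    using v_path unfolding hole_Cons_ends by (simp add: m adjacent_sym)
  then show ?thesis by (simp add: h p m)
qed

lemma hole_starting_at:
  assumes "hole T h" "v \<in> set h"
  obtains p where "hole T (v # p)" "set (v # p) = set h" "length (v # p) = length h"
proof -
  obtain xs ys where h: "h = xs @ v # ys" using assms(2) by (auto simp: in_set_conv_decomp)
  have "hole T (rotate n h)" for n
    by (induction n) (auto simp: assms(1) hole_rotate1)
  from this[of "length xs"] have "hole T (v # ys @ xs)" by (simp add: h rotate_append)
  then show thesis using that[of "ys @ xs"] h by auto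
qed

lemma hole_append:
  assumes "path T p" "path T q" "2 \<le> length p" "2 \<le> length q"
    and "adjacent T (hd p) (last q)" "adjacent T (last p) (hd q)"
    and anti: "\<And>x y. x \<in> set p \<Longrightarrow> y \<in> set q \<Longrightarrow> \<not> (x = hd p \<and> y = last q) \<Longrightarrow>
       \<not> (x = last p \<and> y = hd q) \<Longrightarrow> antiadjacent T x y"
  shows "hole T (p @ q)"
proof -
  obtain x m y where p: "p = x # m @ [y]" using assms(3) by (rule list_ends)
  obtain z n w where q: "q = z # n @ [w]" using assms(4) by (rule list_ends)
  have "distinct p" "distinct q" using assms(1,2) by (auto simp: path_def)
  then have "path T ((m @ [y]) @ q)"
    using assms(1,2,6) anti path_appendD[of T "[x]" "m @ [y]"]
    by (subst path_append) (auto simp: p q)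
  moreover have "interior ((m @ [y]) @ q) = set (tl (m @ [y])) \<union> set (z # n)"
    by (cases m) (auto simp: q interior_def butlast_append)
  moreover have "antiadjacent T x v" if "v \<in> set (tl (m @ [y]))" for v
    using that assms(1) by (cases m) (auto simp: p)
  moreover have "antiadjacent T x v" if "v \<in> set (z # n)" for v
    using that anti \<open>distinct p\<close> \<open>distinct q\<close> by (auto simp: p q)
  ultimately show ?thesis using assms(1,5)
    by (cases m) (auto simp: hole_Cons p q)
qed

lemma hole_card_antiadjacent:
  assumes "hole T h" "v \<in> set h"
  shows "length h - 3 \<le> card {w \<in> set h. antiadjacent T v w}"
proof -
  obtain p where p: "hole T (v # p)" "set (v # p) = set h" "length (v # p) = length h"
    using hole_starting_at[OF assms] .
  then have "length h - 3 = card (interior p)"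
    by (simp add: hole_def distinct_card_interior flip: p(3))
  also have "\<dots> \<le> card {w \<in> set h. antiadjacent T v w}"
    using p(1,2) interior_subset(1)[of p] by (intro card_mono) (auto simp: hole_Cons)
  finally show ?thesis .
qed

lemma antihole_card_adjacent:
  "antihole T h \<Longrightarrow> v \<in> set h \<Longrightarrow> length h - 3 \<le> card {w \<in> set h. adjacent T v w}"
  using hole_card_antiadjacent[of "complement T" h v] by (simp add: antihole_def)

lemma antihole_length_5_imp_hole:
  assumes "antihole T h" "length h = 5"
  obtains h' where "hole T h'" "length h' = 5"
proof -
  obtain a b c d e where h: "h = [a, b, c, d, e]"
    using assms(2) by (auto simp: numeral_eq_Suc length_Suc_conv)
  have "hole T [a, c, e, b, d]"
    using assms(1) unfolding h antihole_def
    by (auto simp: hole_Cons interior_def adjacent_sym antiadjacent_sym vertex_pair_def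
        dest: adjacent_imp_vertex_pair)
  then show thesis using that by auto
qed


section \<open>Embeddings\<close>

definition embeds :: "('a \<Rightarrow> 'b) \<Rightarrow> 'a set \<Rightarrow> 'a trigraph \<Rightarrow> 'b trigraph \<Rightarrow> bool" where
  "embeds f S T T' \<longleftrightarrow> S \<subseteq> verts T \<and> f ` S \<subseteq> verts T' \<and> inj_on f S \<and>
     (\<forall>u\<in>S. \<forall>v\<in>S. u \<noteq> v \<longrightarrow> theta T' {f u, f v} = theta T {u, v})"

lemma embeds_complement: "embeds f S T T' \<Longrightarrow> embeds f S (complement T) (complement T')"
  by (simp add: embeds_def)

context
  fixes f :: "'a \<Rightarrow> 'b" and S T T'
  assumes f: "embeds f S T T'"
begin

lemma embeds_vertex_pair:
  "u \<in> S \<Longrightarrow> v \<in> S \<Longrightarrow> vertex_pair T' (f u) (f v) \<longleftrightarrow> vertex_pair T u v"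
  using f by (auto simp: embeds_def vertex_pair_def inj_on_eq_iff)

lemma embeds_theta:
  "u \<in> S \<Longrightarrow> v \<in> S \<Longrightarrow> vertex_pair T u v \<Longrightarrow> theta T' {f u, f v} = theta T {u, v}"
  using f by (simp add: embeds_def vertex_pair_def)

lemma embeds_relations:
  assumes "u \<in> S" "v \<in> S"
  shows "adjacent T' (f u) (f v) \<longleftrightarrow> adjacent T u v"
    and "antiadjacent T' (f u) (f v) \<longleftrightarrow> antiadjacent T u v"
    and "switchable T' (f u) (f v) \<longleftrightarrow> switchable T u v"
    and "strongly_antiadjacent T' (f u) (f v) \<longleftrightarrow> strongly_antiadjacent T u v"
  using embeds_vertex_pair[OF assms] embeds_theta[OF assms]
  by (auto simp: adjacent_def antiadjacent_def switchable_def strongly_antiadjacent_def)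

lemma path_map: "set p \<subseteq> S \<Longrightarrow> path T' (map f p) \<longleftrightarrow> path T p"
proof (induction p rule: induct_list012)
  case (2 x)
  then show ?case using f by (auto simp: embeds_def)
next
  case (3 x y p)
  then show ?case by (simp add: embeds_relations subset_iff)
qed simp

lemma hole_map: "set h \<subseteq> S \<Longrightarrow> hole T' (map f h) \<longleftrightarrow> hole T h"
proof (cases h)
  case (Cons v p)
  assume "set h \<subseteq> S"
  then show ?thesis
    using Cons interior_subset(1)[of p] path_map[of p]
    by (cases "p = []")
      (auto simp: hole_Cons hd_map last_map interior_map embeds_relations subset_iff)
qed (simp add: hole_def)

end

lemma embeds_Berge_even:
  assumes f: "embeds f S T T'" and "Berge T'" "set h \<subseteq> S" "hole T h \<or> antihole T h"
  shows "even (length h)"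
proof -
  have "hole T' (map f h) \<or> antihole T' (map f h)"
    using assms(4) hole_map[OF f assms(3)] hole_map[OF embeds_complement[OF f] assms(3)]
    by (simp add: antihole_def)
  then have "even (length (map f h))" using \<open>Berge T'\<close> unfolding Berge_def by blast
  then show ?thesis by simp
qed


section \<open>Connectivity\<close>

lemma vertex_in_component:
  assumes "finite (verts T)" "v \<in> verts T"
  obtains Y where "component T Y" "v \<in> Y"
proof -
  let ?S = "{Y. v \<in> Y \<and> Y \<subseteq> verts T \<and> connected T Y}"
  have "finite ?S" using assms(1) by (auto intro: finite_subset[of _ "Pow (verts T)"])
  moreover have "{v} \<in> ?S" using assms(2) by (auto simp: connected_def graph_connected_def)
  ultimately obtain Y where "Y \<in> ?S" and "\<forall>Z\<in>?S. Y \<subseteq> Z \<longrightarrow> Y = Z"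
    using finite_has_maximal2[of ?S "{v}"] by blast
  then have "component T Y" unfolding component_def by blast
  then show thesis using that \<open>Y \<in> ?S\<close> by blast
qed

lemma path_snoc_or_shortcut:
  assumes "trigraph T" "path T p" "adjacent T (last p) z"
  obtains q where "path T q" "hd q = hd p" "last q = z" "set q \<subseteq> insert z (set p)"
proof -
  let ?stop = "\<lambda>u. u = z \<or> adjacent T u z"
  have "p \<noteq> []" using assms(2) by auto
  then have "\<exists>u\<in>set p. ?stop u" using assms(3) last_in_set by blast
  then obtain xs u ys
    where p: "p = xs @ u # ys" and u: "?stop u" and xs: "\<forall>x\<in>set xs. \<not> ?stop x"
    by (rule split_list_first_propE) blast
  have "path T (xs @ [u])" using path_appendD(1)[of T "xs @ [u]" ys] assms(2) p by simp
  show thesis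
  proof (cases "u = z")
    case True
    then show thesis using that[of "xs @ [u]"] \<open>path T (xs @ [u])\<close> p by (cases xs) auto
  next
    case False
    then have "adjacent T u z" using u by blast
    have "antiadjacent T x z" if "x \<in> set xs" for x
    proof -
      have "vertex_pair T x z"
        using that xs assms(2) p \<open>adjacent T u z\<close>
        by (auto simp: path_def vertex_pair_def adjacent_def)
      then show ?thesis using adjacent_or_antiadjacent[OF assms(1)] xs that by blast
    qed
    then have "path T ((xs @ [u]) @ [z])"
      using \<open>path T (xs @ [u])\<close> \<open>adjacent T u z\<close>
      by (subst path_append) (auto simp: adjacent_def vertex_pair_def)
    then show thesis using that[of "xs @ [u, z]"] p by (cases xs) auto
  qed
qed

lemma connected_imp_path:
  assumes "trigraph T" "Y \<subseteq> verts T" "connected T Y" "u \<in> Y" "v \<in> Y"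
  obtains p where "path T p" "hd p = u" "last p = v" "set p \<subseteq> Y"
proof -
  have "(\<lambda>x y. x \<in> Y \<and> y \<in> Y \<and> adjacent (induced T Y) x y)\<^sup>*\<^sup>* u v"
    using assms(3-5) by (simp add: connected_def graph_connected_def)
  then have "\<exists>p. path T p \<and> hd p = u \<and> last p = v \<and> set p \<subseteq> Y"
  proof (induction rule: rtranclp_induct)
    case base
    then show ?case using assms(2,4) by (intro exI[of _ "[u]"]) auto
  next
    case (step y z)
    then obtain p where p: "path T p" "hd p = u" "last p = y" "set p \<subseteq> Y" by blast
    have "z \<in> Y" "adjacent T (last p) z"
      using step.hyps(2) assms(2) p(3) by (auto simp: adjacent_def vertex_pair_def induced_def)
    then obtain q where "path T q" "hd q = hd p" "last q = z" "set q \<subseteq> insert z (set p)"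
      using path_snoc_or_shortcut[OF assms(1) p(1)] by blast
    then show ?case using p \<open>z \<in> Y\<close> by (intro exI[of _ q]) auto
  qed
  then show thesis using that by blast
qed

lemma graph_connected_closed_subset:
  assumes "graph_connected Y E" "Y \<inter> S \<noteq> {}" "\<And>x y. x \<in> S \<Longrightarrow> E x y \<Longrightarrow> y \<in> S"
  shows "Y \<subseteq> S"
proof
  fix v assume "v \<in> Y"
  obtain u where "u \<in> Y" "u \<in> S" using assms(2) by blast
  with assms(1) \<open>v \<in> Y\<close> have "(\<lambda>x y. x \<in> Y \<and> y \<in> Y \<and> E x y)\<^sup>*\<^sup>* u v"
    by (auto simp: graph_connected_def)
  then show "v \<in> S" by (induction rule: rtranclp_induct) (use assms(3) \<open>u \<in> S\<close> in auto)
qed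

lemma graph_connected_image:
  assumes "graph_connected Z E" "\<And>x y. x \<in> Z \<Longrightarrow> y \<in> Z \<Longrightarrow> E x y \<Longrightarrow> E' (f x) (f y)"
  shows "graph_connected (f ` Z) E'"
proof -
  have "(\<lambda>x y. x \<in> f ` Z \<and> y \<in> f ` Z \<and> E' x y)\<^sup>*\<^sup>* (f u) (f v)"
    if "(\<lambda>x y. x \<in> Z \<and> y \<in> Z \<and> E x y)\<^sup>*\<^sup>* u v" for u v
    using that
  proof (induction rule: rtranclp_induct)
    case (step y z)
    then show ?case using assms(2) by (auto intro: rtranclp.rtrancl_into_rtrancl)
  qed simp
  then show ?thesis using assms(1) by (auto simp: graph_connected_def)
qed

lemma graph_component_imageD:
  assumes comp: "graph_component V' E' (f ` Y)"
    and Y: "Y \<noteq> {}" "Y \<subseteq> S" and S: "S \<subseteq> V" "f ` S \<subseteq> V'" and inj: "inj_on f S"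
    and closed: "\<And>x y. x \<in> S \<Longrightarrow> E x y \<Longrightarrow> y \<in> S"
    and edge: "\<And>x y. x \<in> S \<Longrightarrow> y \<in> S \<Longrightarrow> E' (f x) (f y) \<longleftrightarrow> E x y"
  shows "graph_component V E Y"
  unfolding graph_component_def
proof (intro conjI allI impI)
  show "Y \<subseteq> V" using Y(2) S(1) by blast
  have "graph_connected (inv_into S f ` f ` Y) E"
  proof (rule graph_connected_image)
    show "graph_connected (f ` Y) E'" using comp by (simp add: graph_component_def)
  qed (use Y(2) inj edge in \<open>auto simp: subset_iff\<close>)
  then show "graph_connected Y E" using inv_into_image_cancel[OF inj Y(2)] by simp
next
  fix Z assume Z: "Y \<subseteq> Z \<and> Z \<subseteq> V \<and> graph_connected Z E"
  then have "Z \<subseteq> S" using graph_connected_closed_subset[of Z E S] closed Y by blast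
  then have "graph_connected (f ` Z) E'"
    using Z \<open>Z \<subseteq> S\<close> edge by (intro graph_connected_image[of Z E]) (auto simp: subset_iff)
  moreover have "f ` Y \<subseteq> f ` Z" "f ` Z \<subseteq> V'" using Z \<open>Z \<subseteq> S\<close> S(2) by auto
  ultimately have "f ` Z = f ` Y" using comp unfolding graph_component_def by blast
  then show "Z = Y" using inj_on_image_eq_iff[OF inj \<open>Z \<subseteq> S\<close> Y(2)] by simp
qed

definition edges_within :: "('a \<Rightarrow> 'a \<Rightarrow> bool) \<Rightarrow> 'a set \<Rightarrow> 'a set set" where
  "edges_within E Y = {{u, v} |u v. u \<in> Y \<and> v \<in> Y \<and> E u v}"

lemma card_edges_within_image:
  assumes inj: "inj_on f Y" and edge: "\<And>x y. x \<in> Y \<Longrightarrow> y \<in> Y \<Longrightarrow> E' (f x) (f y) \<longleftrightarrow> E x y"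
  shows "card (edges_within E' (f ` Y)) = card (edges_within E Y)"
proof -
  have "edges_within E' (f ` Y) = (`) f ` edges_within E Y"
  proof (intro subset_antisym subsetI)
    fix e assume "e \<in> edges_within E' (f ` Y)"
    then obtain x y where "e = f ` {x, y}" "x \<in> Y" "y \<in> Y" "E x y"
      using edge by (auto simp: edges_within_def)
    then show "e \<in> (`) f ` edges_within E Y" unfolding edges_within_def by blast
  next
    fix e assume "e \<in> (`) f ` edges_within E Y"
    then obtain x y where "e = {f x, f y}" "x \<in> Y" "y \<in> Y" "E x y"
      by (auto simp: edges_within_def)
    then show "e \<in> edges_within E' (f ` Y)" using edge unfolding edges_within_def by blast
  qed
  moreover have "inj_on ((`) f) (edges_within E Y)"
    using inj_on_image_Pow[OF inj] by (rule inj_on_subset) (auto simp: edges_within_def)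
  ultimately show ?thesis by (simp add: card_image)
qed


section \<open>The class F\<close>

definition heavy :: "'a trigraph \<Rightarrow> 'a \<Rightarrow> 'a \<Rightarrow> 'a \<Rightarrow> bool" where
  "heavy T v x y \<longleftrightarrow> strongly_complete T {v} (verts T - {v, x, y}) \<and> strongly_adjacent T x y"

definition light :: "'a trigraph \<Rightarrow> 'a \<Rightarrow> 'a \<Rightarrow> 'a \<Rightarrow> bool" where
  "light T v x y \<longleftrightarrow>
     strongly_anticomplete T {v} (verts T - {v, x, y}) \<and> strongly_antiadjacent T x y"

lemma light_commute: "light T v x y \<longleftrightarrow> light T v y x"
  by (simp add: light_def insert_commute strongly_antiadjacent_sym)

lemma class_F_iff:
  "T \<in> class_F \<longleftrightarrow> trigraph T \<and> Berge T \<and>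
     (\<forall>Y. graph_component (verts T) (switchable T) Y \<longrightarrow>
        card (edges_within (switchable T) Y) \<le> 2) \<and>
     (\<forall>v x y. v \<in> verts T \<and> x \<noteq> y \<and> {w. switchable T v w} = {x, y} \<longrightarrow>
        heavy T v x y \<or> light T v x y)"
  unfolding class_F_def edges_within_def heavy_def light_def by blast

lemma heavy_complement [simp]: "heavy (complement T) = light T"
  by (simp add: fun_eq_iff heavy_def light_def strongly_complete_def strongly_anticomplete_def)

lemma light_complement [simp]: "light (complement T) = heavy T"
  by (simp add: fun_eq_iff heavy_def light_def strongly_complete_def strongly_anticomplete_def)

lemma class_F_complement [simp]: "complement T \<in> class_F \<longleftrightarrow> T \<in> class_F"
  by (auto simp: class_F_iff)

lemma class_F_cong:
  assumes "verts T' = verts T" "\<And>u v. vertex_pair T u v \<Longrightarrow> theta T' {u, v} = theta T {u, v}"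
  shows "T' \<in> class_F \<longleftrightarrow> T \<in> class_F"
proof -
  have pair: "vertex_pair T' = vertex_pair T"
    by (simp add: fun_eq_iff vertex_pair_def assms(1))
  have "trigraph T' \<longleftrightarrow> trigraph T"
    using assms by (simp add: trigraph_iff_pairs pair)
  moreover have "adjacent T' = adjacent T" "antiadjacent T' = antiadjacent T"
    "switchable T' = switchable T" "strongly_adjacent T' = strongly_adjacent T"
    "strongly_antiadjacent T' = strongly_antiadjacent T"
    using assms(2) by (auto simp: fun_eq_iff pair adjacent_def antiadjacent_def switchable_def
        strongly_adjacent_def strongly_antiadjacent_def)
  then have "hole T' = hole T" "antihole T' = antihole T" "switchable T' = switchable T"
     "heavy T' = heavy T" "light T' = light T"
    by (simp_all add: fun_eq_iff hole_def antihole_def assms(1) heavy_def light_def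
        strongly_complete_def strongly_anticomplete_def)
  ultimately show ?thesis by (simp only: class_F_iff Berge_def assms(1))
qed


section \<open>Side paths\<close>

lemma side_path_length:
  assumes "side_path T A B C p" "A \<inter> B = {}"
  shows "2 \<le> length p"
proof -
  have "p \<noteq> []" "hd p \<noteq> last p" using assms by (auto simp: side_path_def)
  then show ?thesis by (cases p) (auto simp: Suc_le_eq)
qed

lemma side_path_set:
  assumes "side_path T A B C p" "A \<inter> B = {}" "x \<in> set p"
  shows "x = hd p \<or> x = last p \<or> x \<in> C"
proof -
  obtain a m b where "p = a # m @ [b]" using side_path_length[OF assms(1,2)] by (rule list_ends)
  then show ?thesis using assms(1,3) by (auto simp: side_path_def)
qed

lemma path_contains_side_path:
  assumes p: "path T p" "hd p \<in> A" "last p \<in> B" "set p \<subseteq> A \<union> B \<union> C" and "A \<inter> B = {}"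
  obtains q where "side_path T A B C q"
proof -
  have "p \<noteq> []" using p(1) by auto
  then have "\<exists>b\<in>set p. b \<in> B" using p(3) last_in_set by blast
  then obtain xs b ys where xs: "p = xs @ b # ys" "b \<in> B" "\<forall>x\<in>set xs. x \<notin> B"
    by (rule split_list_first_propE) blast
  then have "xs \<noteq> []" "hd xs \<in> A" using p(2) \<open>A \<inter> B = {}\<close> by (cases xs; auto)+
  then have "\<exists>a\<in>set xs. a \<in> A" by auto
  then obtain us a vs where us: "xs = us @ a # vs" "a \<in> A" "\<forall>x\<in>set vs. x \<notin> A"
    by (rule split_list_last_propE) blast
  have "path T (a # vs @ [b])"
    using p(1) path_appendD(1)[of T "us @ a # vs @ [b]" ys] path_appendD(2)[of T us "a # vs @ [b]"]
    by (simp add: xs(1) us(1))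
  moreover have "set vs \<subseteq> C" using p(4) xs us by auto
  ultimately have "side_path T A B C (a # vs @ [b])"
    using xs us by (simp add: side_path_def)
  then show thesis by (rule that)
qed

lemma side_path_exists:
  assumes T: "trigraph T" and sub: "A \<union> B \<union> C \<subseteq> verts T"
    and proper: "proper_side T A B C" and "A \<noteq> {}" "A \<inter> B = {}"
  obtains p where "side_path T A B C p"
proof -
  let ?X = "A \<union> B \<union> C"
  obtain a where a: "a \<in> A" using \<open>A \<noteq> {}\<close> by blast
  have "finite ?X" using T sub by (auto simp: trigraph_def intro: finite_subset)
  then obtain Y where Y: "component (induced T ?X) Y" "a \<in> Y"
    using vertex_in_component[of "induced T ?X" a] a by (auto simp: induced_def)
  then obtain b where b: "b \<in> Y" "b \<in> B" using proper by (auto simp: proper_side_def)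
  have "Y \<subseteq> ?X" "connected T Y"
    using Y(1) by (simp_all add: component_def connected_def induced_def)
  then obtain p where "path T p" "hd p = a" "last p = b" "set p \<subseteq> Y"
    using connected_imp_path[of T Y a b] T sub Y(2) b(1) by blast
  then show thesis
    using path_contains_side_path[of T p A B C] that a b(2) \<open>Y \<subseteq> ?X\<close> \<open>A \<inter> B = {}\<close> by blast
qed


section \<open>2-joins of Berge trigraphs\<close>

locale Berge_two_join =
  fixes T :: "'a trigraph" and A1 B1 C1 A2 B2 C2
  assumes trigraph: "trigraph T" and Berge: "Berge T"
    and proper_two_join: "proper_two_join T A1 B1 C1 A2 B2 C2"
begin

abbreviation "X1 \<equiv> A1 \<union> B1 \<union> C1"
abbreviation "X2 \<equiv> A2 \<union> B2 \<union> C2"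
abbreviation "joined u v \<equiv> u \<in> A1 \<and> v \<in> A2 \<or> u \<in> B1 \<and> v \<in> B2"
abbreviation "odd_join \<equiv> odd_two_join T A1 B1 C1 A2 B2 C2"

lemma verts_T: "verts T = X1 \<union> X2" and X1_X2_disjoint: "X1 \<inter> X2 = {}"
  and nonempty: "A1 \<noteq> {}" "B1 \<noteq> {}" "A2 \<noteq> {}" "B2 \<noteq> {}"
  and disjoint1: "A1 \<inter> B1 = {}" "A1 \<inter> C1 = {}" "B1 \<inter> C1 = {}"
  and disjoint2: "A2 \<inter> B2 = {}" "A2 \<inter> C2 = {}" "B2 \<inter> C2 = {}"
  using proper_two_join by (auto simp: proper_two_join_def two_join_def two_join_side_def Let_def)

lemma vertex_pair_cross: "u \<in> X1 \<Longrightarrow> v \<in> X2 \<Longrightarrow> vertex_pair T u v"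
  using X1_X2_disjoint by (auto simp: vertex_pair_def verts_T)

lemma theta_cross:
  assumes "u \<in> X1" "v \<in> X2"
  shows "theta T {u, v} = (if joined u v then 1 else -1)"
    and "theta T {v, u} = (if joined u v then 1 else -1)"
proof -
  show "theta T {u, v} = (if joined u v then 1 else -1)"
    using proper_two_join assms
    by (auto simp: proper_two_join_def two_join_def Let_def strongly_complete_def
        strongly_adjacent_def strongly_antiadjacent_def)
  then show "theta T {v, u} = (if joined u v then 1 else -1)"
    by (simp add: insert_commute)
qed

lemma adjacent_cross:
  assumes "u \<in> X1" "v \<in> X2"
  shows "adjacent T u v \<longleftrightarrow> joined u v"
    and "antiadjacent T u v \<longleftrightarrow> \<not> joined u v"
  using theta_cross(1)[OF assms] vertex_pair_cross[OF assms]
  by (auto simp: adjacent_def antiadjacent_def)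

lemma switchable_X1_closed: "u \<in> X1 \<Longrightarrow> switchable T u v \<Longrightarrow> v \<in> X1"
  using proper_two_join
  by (auto simp: proper_two_join_def two_join_def Let_def switchable_def vertex_pair_def)

lemma side_paths_same_parity:
  assumes p: "side_path T A1 B1 C1 p" and q: "side_path T A2 B2 C2 q"
  shows "even (length p) \<longleftrightarrow> even (length q)"
proof -
  have ends: "hd p \<in> A1" "last p \<in> B1" "hd q \<in> A2" "last q \<in> B2"
    using p q by (auto simp: side_path_def)
  have "hole T (p @ rev q)"
  proof (rule hole_append)
    show "path T p" "path T (rev q)" using p q by (auto simp: side_path_def path_rev)
    show "2 \<le> length p" "2 \<le> length (rev q)"
      using p q disjoint1 disjoint2 by (auto dest: side_path_length)
    show "adjacent T (hd p) (last (rev q))" "adjacent T (last p) (hd (rev q))"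
      using ends by (auto simp: adjacent_cross last_rev hd_rev)
  next
    fix x y
    assume xy: "x \<in> set p" "y \<in> set (rev q)" "\<not> (x = hd p \<and> y = last (rev q))"
      "\<not> (x = last p \<and> y = hd (rev q))"
    have "x = hd p \<or> x = last p \<or> x \<in> C1" "y = hd q \<or> y = last q \<or> y \<in> C2"
      using xy side_path_set[OF p] side_path_set[OF q] disjoint1 disjoint2 by auto
    then show "antiadjacent T x y"
      using xy ends disjoint1 disjoint2 by (subst adjacent_cross) (auto simp: last_rev hd_rev)
  qed
  then have "even (length (p @ rev q))" using Berge unfolding Berge_def by blast
  then show ?thesis by simp
qed

lemma side_path_parity:
  assumes p: "side_path T A1 B1 C1 p"
  shows "even (length p) \<longleftrightarrow> odd_join"
proof -
  obtain q where q: "side_path T A2 B2 C2 q"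
    using side_path_exists[of T A2 B2 C2] trigraph proper_two_join nonempty disjoint2 verts_T
    by (auto simp: proper_two_join_def)
  have "odd (path_length r) \<longleftrightarrow> even (length p)"
    if r: "side_path T A1 B1 C1 r \<or> side_path T A2 B2 C2 r" for r
  proof -
    have "2 \<le> length r" using r disjoint1 disjoint2 by (auto dest: side_path_length)
    then have "odd (path_length r) \<longleftrightarrow> even (length r)" by (cases r) (simp_all add: path_length_def)
    also have "\<dots> \<longleftrightarrow> even (length p)"
      using r side_paths_same_parity[OF p] side_paths_same_parity[OF _ q] q by blast
    finally show ?thesis .
  qed
  then show ?thesis unfolding odd_two_join_def using p by blast
qed

end


section \<open>Blocks of decomposition\<close>

lemma verts_add_markers: "verts (add_markers T X M S W) = Orig ` X \<union> M"
  by (simp add: add_markers_def)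

lemma embeds_add_markers:
  assumes "X \<subseteq> verts T"
  shows "embeds Orig X T (add_markers T X M S W)"
proof -
  have "Orig -` {Orig u, Orig v} = {u, v}" for u v :: 'a by auto
  then show ?thesis using assms by (simp add: embeds_def add_markers_def inj_on_def)
qed

lemma trigraph_add_markers:
  assumes T: "trigraph T" and X: "X \<subseteq> verts T" and "finite M"
  shows "trigraph (add_markers T X M S W)" (is "trigraph ?T'")
  unfolding trigraph_iff_pairs
proof (intro conjI allI impI)
  show "finite (verts ?T')"
    using assms by (auto simp: verts_add_markers trigraph_def intro: finite_subset)
next
  fix u v assume uv: "vertex_pair ?T' u v"
  show "theta ?T' {u, v} \<in> {-1, 0, 1}"
  proof (cases "{u, v} \<subseteq> Orig ` X")
    case True
    then obtain x y where "u = Orig x" "v = Orig y" "x \<in> X" "y \<in> X" by auto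
    then have "vertex_pair T x y" "theta ?T' {u, v} = theta T {x, y}"
      using uv embeds_vertex_pair[OF embeds_add_markers[OF X]]
        embeds_theta[OF embeds_add_markers[OF X]] by auto
    then show ?thesis using T by (simp add: trigraph_iff_pairs)
  qed (auto simp: add_markers_def)
qed

definition two_join_block ::
  "'a trigraph \<Rightarrow> 'a set \<Rightarrow> 'a set \<Rightarrow> 'a set \<Rightarrow> 'a set \<Rightarrow> 'a set \<Rightarrow> 'a set \<Rightarrow>
   'a block_vertex trigraph" where
  "two_join_block T A1 B1 C1 A2 B2 C2 =
     (if odd_two_join T A1 B1 C1 A2 B2 C2 then odd_block T A1 B1 C1 else even_block T A1 B1 C1)"

definition complement_two_join_block ::
  "'a trigraph \<Rightarrow> 'a set \<Rightarrow> 'a set \<Rightarrow> 'a set \<Rightarrow> 'a set \<Rightarrow> 'a set \<Rightarrow> 'a set \<Rightarrow>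
   'a block_vertex trigraph" where
  "complement_two_join_block T A1 B1 C1 A2 B2 C2 =
     (if odd_two_join (complement T) A1 B1 C1 A2 B2 C2 then odd_complement_block T A1 B1 C1
      else even_complement_block T A1 B1 C1)"

lemmas two_join_block_defs = two_join_block_def odd_block_def even_block_def

lemmas complement_two_join_block_defs =
  complement_two_join_block_def odd_complement_block_def even_complement_block_def

primrec retract :: "'a \<Rightarrow> 'a \<Rightarrow> 'a block_vertex \<Rightarrow> 'a" where
  "retract a b (Orig u) = u"
| "retract a b Mark_a = a"
| "retract a b Mark_b = b"
| "retract a b Mark_c = undefined"

context Berge_two_join
begin

abbreviation "block \<equiv> two_join_block T A1 B1 C1 A2 B2 C2"

lemma verts_block:
  "verts block = Orig ` X1 \<union> {Mark_a, Mark_b} \<union> (if odd_join then {} else {Mark_c})"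
  by (auto simp: two_join_block_defs verts_add_markers)

lemma trigraph_block: "trigraph block"
  using trigraph by (auto simp: two_join_block_defs verts_T intro!: trigraph_add_markers)

lemma embeds_Orig: "embeds Orig X1 T block"
  by (auto simp: two_join_block_defs verts_T intro!: embeds_add_markers)

lemma theta_block:
  "theta block {Mark_a, Orig u} = (if u \<in> A1 then 1 else -1)"
  "theta block {Mark_b, Orig u} = (if u \<in> B1 then 1 else -1)"
  "theta block {Mark_c, Orig u} = -1"
  "theta block {Orig u, Mark_a} = (if u \<in> A1 then 1 else -1)"
  "theta block {Orig u, Mark_b} = (if u \<in> B1 then 1 else -1)"
  "theta block {Orig u, Mark_c} = -1"
  "theta block {Mark_a, Mark_b} = (if odd_join then 0 else -1)"
  "\<not> odd_join \<Longrightarrow> theta block {Mark_a, Mark_c} = 0"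
  "\<not> odd_join \<Longrightarrow> theta block {Mark_b, Mark_c} = 0"
  by (auto simp: two_join_block_defs add_markers_def star_def doubleton_eq_iff)

lemma vertex_pair_block:
  "vertex_pair block (Orig u) (Orig v) \<longleftrightarrow> u \<in> X1 \<and> v \<in> X1 \<and> u \<noteq> v"
  "vertex_pair block Mark_a (Orig u) \<longleftrightarrow> u \<in> X1"
  "vertex_pair block Mark_b (Orig u) \<longleftrightarrow> u \<in> X1"
  "vertex_pair block Mark_c (Orig u) \<longleftrightarrow> u \<in> X1 \<and> \<not> odd_join"
  "vertex_pair block Mark_a Mark_b"
  "vertex_pair block Mark_a Mark_c \<longleftrightarrow> \<not> odd_join"
  "vertex_pair block Mark_b Mark_c \<longleftrightarrow> \<not> odd_join"
  "\<not> vertex_pair block w w"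
  by (auto simp: vertex_pair_def verts_block)

lemma adjacent_block:
  "adjacent block Mark_a (Orig u) \<longleftrightarrow> u \<in> A1"
  "adjacent block Mark_b (Orig u) \<longleftrightarrow> u \<in> B1"
  "adjacent block Mark_c (Orig u) \<longleftrightarrow> False"
  "adjacent block Mark_a Mark_b \<longleftrightarrow> odd_join"
  "adjacent block Mark_a Mark_c \<longleftrightarrow> \<not> odd_join"
  "adjacent block Mark_b Mark_c \<longleftrightarrow> \<not> odd_join"
  "\<not> adjacent block w w"
  by (auto simp: adjacent_def vertex_pair_block theta_block split: if_splits)

lemma antiadjacent_block:
  "antiadjacent block Mark_a (Orig u) \<longleftrightarrow> u \<in> X1 - A1"
  "antiadjacent block Mark_b (Orig u) \<longleftrightarrow> u \<in> X1 - B1"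
  by (auto simp: antiadjacent_def vertex_pair_block theta_block split: if_splits)

lemma switchable_block:
  "switchable block Mark_a (Orig u) \<longleftrightarrow> False"
  "switchable block Mark_b (Orig u) \<longleftrightarrow> False"
  "switchable block Mark_c (Orig u) \<longleftrightarrow> False"
  "switchable block Mark_a Mark_b \<longleftrightarrow> odd_join"
  "switchable block Mark_a Mark_c \<longleftrightarrow> \<not> odd_join"
  "switchable block Mark_b Mark_c \<longleftrightarrow> \<not> odd_join"
  "switchable block (Orig u) (Orig v) \<longleftrightarrow> u \<in> X1 \<and> v \<in> X1 \<and> switchable T u v"
  "\<not> switchable block w w"
  using embeds_relations(3)[OF embeds_Orig, of u v]
  by (auto simp: switchable_def vertex_pair_block theta_block split: if_splits)

lemma strongly_antiadjacent_block:
  "strongly_antiadjacent block Mark_a (Orig u) \<longleftrightarrow> u \<in> X1 - A1"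
  "strongly_antiadjacent block Mark_b (Orig u) \<longleftrightarrow> u \<in> X1 - B1"
  "strongly_antiadjacent block Mark_c (Orig u) \<longleftrightarrow> u \<in> X1 \<and> \<not> odd_join"
  "strongly_antiadjacent block Mark_a Mark_b \<longleftrightarrow> \<not> odd_join"
  by (auto simp: strongly_antiadjacent_def vertex_pair_block theta_block split: if_splits)

lemmas block_relations [simp] =
  adjacent_block adjacent_block(1-6)[THEN trans[OF adjacent_sym]]
  antiadjacent_block antiadjacent_block(1-2)[THEN trans[OF antiadjacent_sym]]
  switchable_block switchable_block(1-6)[THEN trans[OF switchable_sym]]
  strongly_antiadjacent_block
  strongly_antiadjacent_block[THEN trans[OF strongly_antiadjacent_sym]]
  embeds_relations[OF embeds_Orig]


section \<open>Holes and antiholes of a block\<close>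

lemma adjacent_Mark_c: "adjacent block Mark_c z \<Longrightarrow> z \<in> {Mark_a, Mark_b}"
  by (cases z) auto

lemma embeds_retract:
  assumes "a \<in> A2" "b \<in> B2" "m \<in> {Mark_a, Mark_b}"
  shows "embeds (retract a b) (verts block - {m, Mark_c}) block T"
proof -
  let ?S = "verts block - {m, Mark_c}"
  have ab: "a \<in> X2 - X1 - B2" "b \<in> X2 - X1 - A2"
    using assms(1,2) disjoint2 X1_X2_disjoint by auto
  have theta_Orig: "theta block {Orig u, Orig v} = theta T {u, v}"
    if "u \<in> X1" "v \<in> X1" "u \<noteq> v" for u v
    using embeds_Orig that by (simp add: embeds_def)
  have "theta T {retract a b u, retract a b v} = theta block {u, v} \<and>
      retract a b u \<noteq> retract a b v"
    if "u \<in> ?S" "v \<in> ?S" "u \<noteq> v" for u v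
    using that assms ab by (cases u; cases v)
      (auto simp: verts_block theta_cross theta_block theta_Orig split: if_splits)
  moreover have "retract a b u \<in> verts T" if "u \<in> ?S" for u
    using that ab by (cases u) (auto simp: verts_block verts_T split: if_splits)
  ultimately show ?thesis unfolding embeds_def inj_on_def by blast
qed

lemma hole_avoiding_marker_even:
  assumes hole: "hole block h \<or> antihole block h"
    and m: "m \<in> {Mark_a, Mark_b}" "m \<notin> set h" "Mark_c \<notin> set h"
  shows "even (length h)"
proof -
  obtain a b where "a \<in> A2" "b \<in> B2" using nonempty by blast
  then have "embeds (retract a b) (verts block - {m, Mark_c}) block T"
    using m(1) by (rule embeds_retract)
  moreover have "set h \<subseteq> verts block - {m, Mark_c}"
    using hole m(2,3) hole_verts[of block h] hole_verts[of "complement block" h]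
    by (auto simp: antihole_def)
  ultimately show ?thesis using embeds_Berge_even Berge hole by blast
qed

lemma segment_through_Mark_c:
  assumes hole: "hole block (Mark_a # P @ Mark_b # Q)" and "Mark_c \<in> set P"
  shows "P = [Mark_c]"
proof -
  obtain P1 P2 where P: "P = P1 @ Mark_c # P2" using assms(2) by (auto simp: in_set_conv_decomp)
  have path: "path block (P1 @ Mark_c # P2 @ Mark_b # Q)" using hole by (simp add: P hole_Cons)
  have isolated: "\<not> adjacent block Mark_c z" if "z \<in> set P" for z
    using hole_distinct[OF hole] that adjacent_Mark_c[of z] by auto
  have "P1 = []"
  proof (rule ccontr)
    assume "P1 \<noteq> []"
    then have "last P1 \<in> set P" by (simp add: P)
    moreover have "adjacent block Mark_c (last P1)"
      using path \<open>P1 \<noteq> []\<close> by (simp add: path_append adjacent_sym)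
    ultimately show False using isolated by blast
  qed
  moreover have "P2 = []"
  proof (cases P2)
    case (Cons z P3)
    then have "adjacent block Mark_c z"
      using path path_appendD(2)[of block P1 "Mark_c # z # P3 @ Mark_b # Q"] by simp
    then show ?thesis using isolated[of z] by (simp add: P Cons)
  qed
  ultimately show ?thesis using P by simp
qed

lemma segment_avoiding_Mark_c:
  assumes hole: "hole block (Mark_a # P @ Mark_b # Q)" and "P \<noteq> []" "Mark_c \<notin> set P"
  obtains q where "side_path T A1 B1 C1 q" "P = map Orig q"
proof -
  have path: "path block (P @ Mark_b # Q)" and adjacent_a: "adjacent block Mark_a (hd P)"
    and antiadjacent_a: "\<And>z. z \<in> set (tl P) \<Longrightarrow> antiadjacent block Mark_a z"
    using hole \<open>P \<noteq> []\<close> by (auto simp: hole_Cons interior_def butlast_append)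
  then have P: "path block P" and adjacent_b: "adjacent block (last P) Mark_b"
    and antiadjacent_b: "\<And>z. z \<in> set (butlast P) \<Longrightarrow> antiadjacent block z Mark_b"
    using path_append[of P "Mark_b # Q"] \<open>P \<noteq> []\<close> by auto
  have "set P \<subseteq> Orig ` X1"
    using hole_verts[OF hole] hole_distinct[OF hole] \<open>Mark_c \<notin> set P\<close>
    by (auto simp: verts_block split: if_splits)
  then have "\<exists>q. P = map Orig q" unfolding ex_map_conv by blast
  then obtain q where q: "P = map Orig q" ..
  then have "set q \<subseteq> X1" using \<open>set P \<subseteq> Orig ` X1\<close> by auto
  have "z \<in> C1" if "z \<in> interior q" for z
  proof -
    have "Orig z \<in> interior P" using that q by (simp add: interior_map)
    then have "Orig z \<in> set (tl P)" "Orig z \<in> set (butlast P)"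
      using interior_subset[of P] by auto
    then show ?thesis using antiadjacent_a antiadjacent_b by fastforce
  qed
  moreover have "path T q" using P q path_map[OF embeds_Orig \<open>set q \<subseteq> X1\<close>] by simp
  moreover have "hd q \<in> A1" "last q \<in> B1" using adjacent_a adjacent_b q \<open>P \<noteq> []\<close>
    by (auto simp: hd_map last_map)
  ultimately show thesis using that[of q] q by (auto simp: side_path_def)
qed

lemma segment_parity:
  assumes hole: "hole block (Mark_a # P @ Mark_b # Q)"
  shows "even (length P) \<longleftrightarrow> odd_join"
proof -
  consider (empty) "P = []" | (Mark_c) "Mark_c \<in> set P" | (side_path) "P \<noteq> []" "Mark_c \<notin> set P"
    by blast
  then show ?thesis
  proof cases
    case empty
    then show ?thesis using hole by (simp add: hole_Cons)
  next
    case Mark_c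
    then have "Mark_c \<in> verts block" "P = [Mark_c]"
      using hole_verts[OF hole] segment_through_Mark_c[OF hole] by auto
    then show ?thesis by (auto simp: verts_block split: if_splits)
  next
    case side_path
    then obtain q where "side_path T A1 B1 C1 q" "P = map Orig q"
      by (rule segment_avoiding_Mark_c[OF hole])
    then show ?thesis using side_path_parity by simp
  qed
qed

lemma hole_through_Mark_c_contains_markers:
  assumes "hole block h" "Mark_c \<in> set h"
  shows "{Mark_a, Mark_b} \<subseteq> set h"
proof -
  obtain p where p: "hole block (Mark_c # p)" "set (Mark_c # p) = set h"
    using hole_starting_at[OF assms] .
  then have "2 \<le> length p" using hole_length by fastforce
  then obtain x m y where p_ends: "p = x # m @ [y]" by (rule list_ends)
  then have "x \<in> {Mark_a, Mark_b}" "y \<in> {Mark_a, Mark_b}" "x \<noteq> y"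
    using p(1) hole_distinct[OF p(1)] adjacent_Mark_c by (auto simp: hole_Cons_ends)
  then show ?thesis using p(2) p_ends by auto
qed

lemma hole_block_even:
  assumes hole: "hole block h"
  shows "even (length h)"
proof (cases "{Mark_a, Mark_b} \<subseteq> set h")
  case True
  then obtain p where p: "hole block (Mark_a # p)" "set (Mark_a # p) = set h"
    "length (Mark_a # p) = length h"
    using hole_starting_at[OF hole, of Mark_a] by auto
  then have "Mark_b \<in> set p" using True by auto
  then obtain P Q where p_split: "p = P @ Mark_b # Q" by (auto simp: in_set_conv_decomp)
  have "hole block (Mark_a # P @ Mark_b # Q)" "hole block (Mark_a # rev Q @ Mark_b # rev P)"
    using p(1) hole_rev_tl[OF p(1)] by (simp_all add: p_split)
  then have "even (length P) \<longleftrightarrow> even (length Q)" using segment_parity by (metis length_rev)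
  moreover have "length h = length P + length Q + 2" using p(3) p_split by simp
  ultimately show ?thesis by simp
next
  case False
  then have "Mark_c \<notin> set h" using hole_through_Mark_c_contains_markers[OF hole] by blast
  then show ?thesis using False hole hole_avoiding_marker_even by blast
qed

lemma long_antihole_avoids_Mark_c:
  assumes "antihole block h" "7 \<le> length h"
  shows "Mark_c \<notin> set h"
proof
  let ?N = "{w \<in> set h. adjacent block Mark_c w}"
  assume "Mark_c \<in> set h"
  then have "4 \<le> card ?N" using antihole_card_adjacent[OF assms(1), of Mark_c] assms(2) by simp
  moreover have "?N \<subseteq> {Mark_a, Mark_b}" using adjacent_Mark_c by auto
  then have "card ?N \<le> 2" using card_mono[of "{Mark_a, Mark_b}" ?N] by simp
  ultimately show False by simp
qed

lemma long_antihole_avoids_Mark_a_or_Mark_b: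
  assumes "antihole block h" "7 \<le> length h"
  shows "Mark_a \<notin> set h \<or> Mark_b \<notin> set h"
proof (rule ccontr)
  define N where "N v = {w \<in> set h. adjacent block v w}" for v
  assume "\<not> (Mark_a \<notin> set h \<or> Mark_b \<notin> set h)"
  then have "2 * (length h - 3) \<le> card (N Mark_a) + card (N Mark_b)"
    using antihole_card_adjacent[OF assms(1), of Mark_a]
      antihole_card_adjacent[OF assms(1), of Mark_b] by (simp add: N_def)
  also have "\<dots> = card (N Mark_a \<union> N Mark_b)"
  proof (rule card_Un_disjoint[symmetric])
    have "\<not> (adjacent block Mark_a w \<and> adjacent block Mark_b w)" if "w \<in> set h" for w
    proof (cases w)
    qed (use that long_antihole_avoids_Mark_c[OF assms] disjoint1 in auto)
    then show "N Mark_a \<inter> N Mark_b = {}" by (auto simp: N_def)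
  qed (simp_all add: N_def)
  also have "\<dots> \<le> card (set h)" by (intro card_mono) (auto simp: N_def)
  also have "\<dots> \<le> length h" by (rule card_length)
  finally show False using assms(2) by simp
qed

lemma antihole_block_even:
  assumes antihole: "antihole block h"
  shows "even (length h)"
proof (rule ccontr)
  assume odd: "odd (length h)"
  have "length h \<noteq> 5"
  proof
    assume "length h = 5"
    with antihole obtain h' where "hole block h'" "length h' = 5"
      by (rule antihole_length_5_imp_hole)
    then show False using hole_block_even[of h'] by simp
  qed
  moreover have "4 \<le> length h" using antihole hole_length by (auto simp: antihole_def)
  ultimately have "7 \<le> length h" using odd by presburger
  then have "Mark_c \<notin> set h" "Mark_a \<notin> set h \<or> Mark_b \<notin> set h"
    using antihole long_antihole_avoids_Mark_c long_antihole_avoids_Mark_a_or_Mark_b by blast+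
  then show False using hole_avoiding_marker_even antihole odd by blast
qed

lemma Berge_block: "Berge block"
  using hole_block_even antihole_block_even by (simp add: Berge_def)


section \<open>Switchable pairs of a block\<close>

lemma card_edges_within_markers:
  assumes "Y \<subseteq> {Mark_a, Mark_b, Mark_c}"
  shows "card (edges_within (switchable block) Y) \<le> 2"
proof -
  have "edges_within (switchable block) Y \<subseteq>
      (if odd_join then {{Mark_a, Mark_b}} else {{Mark_a, Mark_c}, {Mark_b, Mark_c}})"
    (is "_ \<subseteq> ?M")
  proof
    fix e assume "e \<in> edges_within (switchable block) Y"
    then obtain u v where "e = {u, v}" "u \<in> {Mark_a, Mark_b, Mark_c}"
      "v \<in> {Mark_a, Mark_b, Mark_c}" "switchable block u v"
      using assms unfolding edges_within_def by blast
    then show "e \<in> ?M" by (auto simp: insert_commute)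
  qed
  then have "card (edges_within (switchable block) Y) \<le> card ?M"
    by (rule card_mono[rotated]) simp
  also have "\<dots> \<le> 2" by (simp add: card_insert_if)
  finally show ?thesis .
qed

lemma switchable_component_block_card_edges:
  assumes class_F: "T \<in> class_F" and comp: "graph_component (verts block) (switchable block) Y"
  shows "card (edges_within (switchable block) Y) \<le> 2"
proof (cases "Y \<inter> Orig ` X1 = {}")
  case True
  have "Y \<subseteq> verts block" using comp by (simp add: graph_component_def)
  then have "Y \<subseteq> {Mark_a, Mark_b, Mark_c}"
    using True by (auto simp: verts_block split: if_splits)
  then show ?thesis by (rule card_edges_within_markers)
next
  case False
  have "v \<in> Orig ` X1" if "u \<in> Orig ` X1" "switchable block u v" for u v
    using that by (cases v) auto
  then have "Y \<subseteq> Orig ` X1"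
    using comp False graph_connected_closed_subset unfolding graph_component_def by metis
  then obtain Z where Z: "Z \<subseteq> X1" "Y = Orig ` Z" by (rule subset_imageE)
  have "graph_component (verts T) (switchable T) Z"
  proof (rule graph_component_imageD)
    show "graph_component (verts block) (switchable block) (Orig ` Z)" using comp Z(2) by simp
    show "Z \<noteq> {}" using False Z(2) by blast
    show "y \<in> X1" if "x \<in> X1" "switchable T x y" for x y using switchable_X1_closed that .
  qed (use Z(1) in \<open>auto simp: verts_T verts_block inj_on_def\<close>)
  then have "card (edges_within (switchable T) Z) \<le> 2" using class_F by (simp add: class_F_iff)
  moreover have "card (edges_within (switchable block) (Orig ` Z)) =
      card (edges_within (switchable T) Z)"
    by (rule card_edges_within_image) (use Z(1) in \<open>auto simp: inj_on_def\<close>)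
  ultimately show ?thesis using Z(2) by simp
qed

lemma not_strongly_adjacent_to_X2:
  assumes "u \<in> X1"
  obtains w where "w \<in> X2" "\<not> strongly_adjacent T u w"
proof -
  obtain a b where "a \<in> A2" "b \<in> B2" using nonempty by blast
  then show thesis
    using that[of a] that[of b] theta_cross(1)[OF assms, of a] theta_cross(1)[OF assms, of b]
      disjoint1 disjoint2 by (auto simp: strongly_adjacent_def split: if_splits)
qed

lemma strongly_anticomplete_to_X2_imp_C1:
  assumes "u \<in> X1" "strongly_anticomplete T {u} X2"
  shows "u \<in> C1"
proof -
  obtain a b where "a \<in> A2" "b \<in> B2" using nonempty by blast
  then show ?thesis
    using assms theta_cross(1)[OF assms(1), of a] theta_cross(1)[OF assms(1), of b]
    by (auto simp: strongly_anticomplete_def strongly_antiadjacent_def split: if_splits)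
qed

lemma light_Orig:
  assumes light: "light T u x y" and X1: "u \<in> X1" "x \<in> X1" "y \<in> X1"
  shows "light block (Orig u) (Orig x) (Orig y)"
proof -
  have rest: "strongly_antiadjacent T u w" if "w \<in> X1 \<union> X2 - {u, x, y}" for w
    using light that by (simp add: light_def strongly_anticomplete_def verts_T)
  have "X2 \<inter> {u, x, y} = {}" using X1 X1_X2_disjoint by blast
  then have "u \<in> C1" using rest strongly_anticomplete_to_X2_imp_C1[OF X1(1)]
    by (auto simp: strongly_anticomplete_def)
  have "strongly_antiadjacent block (Orig u) w"
    if "w \<in> verts block - {Orig u, Orig x, Orig y}" for w
    using that rest X1(1) \<open>u \<in> C1\<close> disjoint1
    by (cases w) (auto simp: verts_block split: if_splits)
  moreover have "strongly_antiadjacent T x y" using light by (simp add: light_def)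
  ultimately show ?thesis using X1 by (simp add: light_def strongly_anticomplete_def)
qed

lemma switchable_degree_two_Orig_light:
  assumes class_F: "T \<in> class_F" and u: "u \<in> X1" and "x \<noteq> y"
    and nbrs: "{w. switchable block (Orig u) w} = {x, y}"
  shows "light block (Orig u) x y"
proof -
  have switchable_iff: "switchable block (Orig u) w \<longleftrightarrow> w = x \<or> w = y" for w using nbrs by blast
  obtain x' where x: "x = Orig x'" "x' \<in> X1" using switchable_iff[of x] by (cases x) auto
  obtain y' where y: "y = Orig y'" "y' \<in> X1" using switchable_iff[of y] by (cases y) auto
  have "switchable T u w \<longleftrightarrow> w = x' \<or> w = y'" for w
    using switchable_iff[of "Orig w"] switchable_X1_closed[OF u, of w] u x y by auto
  then have "{w. switchable T u w} = {x', y'}" by blast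
  moreover have "x' \<noteq> y'" "u \<in> verts T" using \<open>x \<noteq> y\<close> x y u by (auto simp: verts_T)
  ultimately have "heavy T u x' y' \<or> light T u x' y'" using class_F unfolding class_F_iff by blast
  moreover have "\<not> heavy T u x' y'"
  proof -
    obtain w where "w \<in> X2" "\<not> strongly_adjacent T u w"
      using not_strongly_adjacent_to_X2[OF u] .
    moreover have "w \<in> verts T - {u, x', y'}"
      using \<open>w \<in> X2\<close> u x y X1_X2_disjoint unfolding verts_T by blast
    ultimately show ?thesis by (auto simp: heavy_def strongly_complete_def)
  qed
  ultimately show ?thesis using light_Orig u x y by simp
qed

lemma light_Mark_c:
  assumes "\<not> odd_join"
  shows "light block Mark_c Mark_a Mark_b"
proof -
  have "verts block - {Mark_c, Mark_a, Mark_b} = Orig ` X1" by (auto simp: verts_block)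
  then show ?thesis using assms by (auto simp: light_def strongly_anticomplete_def)
qed

lemma switchable_degree_two_block_light:
  assumes class_F: "T \<in> class_F" and v: "v \<in> verts block" and "x \<noteq> y"
    and nbrs: "{w. switchable block v w} = {x, y}"
  shows "light block v x y"
proof (cases v)
  case (Orig u)
  then show ?thesis using switchable_degree_two_Orig_light class_F v \<open>x \<noteq> y\<close> nbrs
    by (auto simp: verts_block split: if_splits)
next
  case Mark_c
  have "\<not> odd_join" using v Mark_c by (auto simp: verts_block split: if_splits)
  then have "Mark_a \<in> {x, y}" "Mark_b \<in> {x, y}"
    using Mark_c unfolding nbrs[symmetric] by simp_all
  then have "x = Mark_a \<and> y = Mark_b \<or> x = Mark_b \<and> y = Mark_a" by auto
  then show ?thesis
    using light_Mark_c[OF \<open>\<not> odd_join\<close>] light_commute[of block Mark_c] Mark_c by auto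
next
  case Mark_a
  have "switchable block v x" "switchable block v y" using nbrs by blast+
  then show ?thesis using \<open>x \<noteq> y\<close> Mark_a by (cases x; cases y) auto
next
  case Mark_b
  have "switchable block v x" "switchable block v y" using nbrs by blast+
  then show ?thesis using \<open>x \<noteq> y\<close> Mark_b by (cases x; cases y) auto
qed

lemma block_in_class_F: "T \<in> class_F \<Longrightarrow> block \<in> class_F"
  using trigraph_block Berge_block switchable_component_block_card_edges
    switchable_degree_two_block_light
  by (auto simp: class_F_iff)

end


section \<open>Blocks in the class F\<close>

lemma two_join_block_in_class_F:
  assumes "T \<in> class_F" "proper_two_join T A1 B1 C1 A2 B2 C2"
  shows "two_join_block T A1 B1 C1 A2 B2 C2 \<in> class_F"
proof -
  interpret Berge_two_join T A1 B1 C1 A2 B2 C2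
    using assms by unfold_locales (simp_all add: class_F_iff)
  show ?thesis using assms(1) by (rule block_in_class_F)
qed

lemma theta_complement_two_join_block:
  assumes join: "proper_two_join (complement T) A1 B1 C1 A2 B2 C2"
    and uv: "vertex_pair (two_join_block (complement T) A1 B1 C1 A2 B2 C2) u v"
  shows "theta (complement_two_join_block T A1 B1 C1 A2 B2 C2) {u, v} =
    - theta (two_join_block (complement T) A1 B1 C1 A2 B2 C2) {u, v}"
proof -
  have "A1 \<inter> B1 = {}" "A1 \<inter> C1 = {}" "B1 \<inter> C1 = {}"
    using join by (auto simp: proper_two_join_def two_join_def two_join_side_def Let_def)
  then show ?thesis
    using uv unfolding vertex_pair_def
    by (cases u; cases v) (auto simp: complement_two_join_block_defs two_join_block_defs
        add_markers_def star_def doubleton_eq_iff split: if_splits)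
qed

lemma complement_two_join_block_in_class_F:
  assumes "T \<in> class_F" "proper_two_join (complement T) A1 B1 C1 A2 B2 C2"
  shows "complement_two_join_block T A1 B1 C1 A2 B2 C2 \<in> class_F"
proof -
  let ?block = "two_join_block (complement T) A1 B1 C1 A2 B2 C2"
  have "complement ?block \<in> class_F"
    using assms two_join_block_in_class_F[of "complement T"] by simp
  moreover have "complement_two_join_block T A1 B1 C1 A2 B2 C2 \<in> class_F \<longleftrightarrow>
      complement ?block \<in> class_F"
  proof (rule class_F_cong)
    show "verts (complement_two_join_block T A1 B1 C1 A2 B2 C2) = verts (complement ?block)"
      by (simp add: complement_two_join_block_defs two_join_block_defs verts_add_markers)
  qed (simp add: theta_complement_two_join_block[OF assms(2)])
  ultimately show ?thesis by blast
qed

theorem theorem4p1: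
  fixes T :: "'a trigraph" and X :: "'a set" and TX :: "'a block_vertex trigraph"
  assumes "T \<in> class_F"
    and "\<nexists>A B. balanced_skew_partition T A B"
    and "fragment T X"
    and "block_of_decomposition T X TX"
  shows "TX \<in> class_F"
proof -
  consider (two_join) A1 B1 C1 A2 B2 C2 where
      "proper_two_join T A1 B1 C1 A2 B2 C2"
      "TX = two_join_block T A1 B1 C1 A2 B2 C2"
    | (complement_two_join) A1 B1 C1 A2 B2 C2 where
      "proper_two_join (complement T) A1 B1 C1 A2 B2 C2"
      "TX = complement_two_join_block T A1 B1 C1 A2 B2 C2"
    using assms(4) unfolding block_of_decomposition_def proper_complement_two_join_def
      two_join_block_def complement_two_join_block_def by blast
  then show ?thesis
  proof cases
    case two_join
    then show ?thesis using two_join_block_in_class_F assms(1) by simp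
  next
    case complement_two_join
    then show ?thesis using complement_two_join_block_in_class_F assms(1) by simp
  qed
qed

end
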